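(* Let $(X,\tau,E)$ be a soft topological space. The collection $S\beta r\text{-}h(X,\tau,E)$ forms a group under the composition of functions.
   Context: Let $X$ be a set and $E$ a non-empty set of parameters. A soft set $(F,E)$ over $X$ is a mapping $F:E\to P(X)$. Inclusion $\widetilde{\subseteq}$, union and intersection of soft sets are taken parameterwise (for each $e\in E$); $\Phi$ is the soft set with value $\emptyset$ at every $e$, $\widetilde{X}$ the soft set with value $X$ at every $e$. The relative complement of $(F,E)$ is the soft set $e\mapsto X\setminus F(e)$. A soft topology on $X$ is a collection $\tau$ of soft sets over $X$ containing $\Phi$ and $\widetilde{X}$ and closed under arbitrary unions and intersections of two members; $(X,\tau,E)$ is then a soft topological space. Members of $\tau$ are soft open; a soft set is soft closed if its relative complement is in $\tau$. $int(F,E)$ is the union of all soft open sets contained in $(F,E)$, and $cl(F,E)$ is the intersection of all soft closed sets containing $(F,E)$. The soft set $(F,E)$ is soft $\beta$-open if $(F,E)\,\widetilde{\subseteq}\,cl(int(cl(F,E)))$. A function $f:(X,\tau,E)\to(Y,\tau',E)$ between soft topological spaces is a function $f:X\to Y$, with inverse images of soft sets given by $f^{-1}(G,E)(e)=f^{-1}(G(e))$ for all $e\in E$. It is soft $\beta$-irresolute if $f^{-1}(G,E)$ is soft $\beta$-open in $(X,\tau,E)$ for every soft $\beta$-open set $(G,E)$ of $(Y,\tau',E)$. $S\beta r\text{-}h(X,\tau,E)$ is the set of all bijections $f:(X,\tau,E)\to(X,\tau,E)$ such that both $f$ and $f^{-1}$ are soft $\beta$-irresolute. (The group operation is $\alpha(a,b)=b\circ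 a$.) *)

theory Defs
  imports "HOL-Algebra.Bij"
begin

text \<open>
  The underlying set \<open>X\<close> and the parameter set \<open>E\<close> are explicit carriers. Mappings with
  domain \<open>E\<close> (or \<open>X\<close>) are represented by extensional functions, i.e. functions that are
  \<open>undefined\<close> outside of their domain, so that equality of mappings is HOL equality.
\<close>

type_synonym ('e, 'a) soft_set = "'e \<Rightarrow> 'a set"

definition soft_sets :: "'a set \<Rightarrow> 'e set \<Rightarrow> ('e, 'a) soft_set set" where
  "soft_sets X E = (E \<rightarrow>\<^sub>E Pow X)"

definition soft_subset :: "'e set \<Rightarrow> ('e, 'a) soft_set \<Rightarrow> ('e, 'a) soft_set \<Rightarrow> bool" where
  "soft_subset E F G \<longleftrightarrow> (\<forall>e\<in>E. F e \<subseteq> G e)"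

definition soft_Union :: "'e set \<Rightarrow> ('e, 'a) soft_set set \<Rightarrow> ('e, 'a) soft_set" where
  "soft_Union E S = (\<lambda>e\<in>E. \<Union>F\<in>S. F e)"

text \<open>Only meaningful for nonempty families; the family in \<open>soft_cl\<close> below always
  contains the full soft set when \<open>\<tau>\<close> is a soft topology.\<close>
definition soft_Inter :: "'e set \<Rightarrow> ('e, 'a) soft_set set \<Rightarrow> ('e, 'a) soft_set" where
  "soft_Inter E S = (\<lambda>e\<in>E. \<Inter>F\<in>S. F e)"

definition soft_inter :: "'e set \<Rightarrow> ('e, 'a) soft_set \<Rightarrow> ('e, 'a) soft_set \<Rightarrow> ('e, 'a) soft_set" where
  "soft_inter E F G = (\<lambda>e\<in>E. F e \<inter> G e)"

definition soft_empty :: "'e set \<Rightarrow> ('e, 'a) soft_set" where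
  "soft_empty E = (\<lambda>e\<in>E. {})"

definition soft_full :: "'a set \<Rightarrow> 'e set \<Rightarrow> ('e, 'a) soft_set" where
  "soft_full X E = (\<lambda>e\<in>E. X)"

definition soft_compl :: "'a set \<Rightarrow> 'e set \<Rightarrow> ('e, 'a) soft_set \<Rightarrow> ('e, 'a) soft_set" where
  "soft_compl X E F = (\<lambda>e\<in>E. X - F e)"

definition soft_topological_space :: "'a set \<Rightarrow> ('e, 'a) soft_set set \<Rightarrow> 'e set \<Rightarrow> bool" where
  "soft_topological_space X \<tau> E \<longleftrightarrow>
     E \<noteq> {} \<and>
     \<tau> \<subseteq> soft_sets X E \<and>
     soft_empty E \<in> \<tau> \<and>
     soft_full X E \<in> \<tau> \<and>
     (\<forall>S. S \<subseteq> \<tau> \<longrightarrow> soft_Union E S \<in> \<tau>) \<and>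
     (\<forall>F\<in>\<tau>. \<forall>G\<in>\<tau>. soft_inter E F G \<in> \<tau>)"

definition soft_closed :: "'a set \<Rightarrow> ('e, 'a) soft_set set \<Rightarrow> 'e set \<Rightarrow> ('e, 'a) soft_set \<Rightarrow> bool" where
  "soft_closed X \<tau> E F \<longleftrightarrow> F \<in> soft_sets X E \<and> soft_compl X E F \<in> \<tau>"

definition soft_int :: "('e, 'a) soft_set set \<Rightarrow> 'e set \<Rightarrow> ('e, 'a) soft_set \<Rightarrow> ('e, 'a) soft_set" where
  "soft_int \<tau> E F = soft_Union E {G \<in> \<tau>. soft_subset E G F}"

definition soft_cl ::
  "'a set \<Rightarrow> ('e, 'a) soft_set set \<Rightarrow> 'e set \<Rightarrow> ('e, 'a) soft_set \<Rightarrow> ('e, 'a) soft_set" where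
  "soft_cl X \<tau> E F = soft_Inter E {H. soft_closed X \<tau> E H \<and> soft_subset E F H}"

definition soft_beta_open ::
  "'a set \<Rightarrow> ('e, 'a) soft_set set \<Rightarrow> 'e set \<Rightarrow> ('e, 'a) soft_set \<Rightarrow> bool" where
  "soft_beta_open X \<tau> E F \<longleftrightarrow>
     F \<in> soft_sets X E \<and>
     soft_subset E F (soft_cl X \<tau> E (soft_int \<tau> E (soft_cl X \<tau> E F)))"

definition soft_vimage ::
  "'a set \<Rightarrow> 'e set \<Rightarrow> ('a \<Rightarrow> 'b) \<Rightarrow> ('e, 'b) soft_set \<Rightarrow> ('e, 'a) soft_set" where
  "soft_vimage X E f G = (\<lambda>e\<in>E. f -` G e \<inter> X)"

definition soft_beta_irresolute ::
  "'a set \<Rightarrow> ('e, 'a) soft_set set \<Rightarrow> 'b set \<Rightarrow> ('e, 'b) soft_set set \<Rightarrow> 'e set \<Rightarrow> ('a \<Rightarrow> 'b) \<Rightarrow> bool" where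
  "soft_beta_irresolute X \<tau> Y \<tau>' E f \<longleftrightarrow>
     f \<in> X \<rightarrow> Y \<and>
     (\<forall>G. soft_beta_open Y \<tau>' E G \<longrightarrow> soft_beta_open X \<tau> E (soft_vimage X E f G))"

text \<open>\<open>Bij X\<close> is the set of (extensional) bijections from \<open>X\<close> onto \<open>X\<close>.\<close>
definition Sbr_h :: "'a set \<Rightarrow> ('e, 'a) soft_set set \<Rightarrow> 'e set \<Rightarrow> ('a \<Rightarrow> 'a) set" where
  "Sbr_h X \<tau> E =
     {f \<in> Bij X. soft_beta_irresolute X \<tau> X \<tau> E f \<and>
                  soft_beta_irresolute X \<tau> X \<tau> E (restrict (inv_into X f) X)}"

text \<open>The product of \<open>a\<close> and \<open>b\<close> is \<open>b \<circ> a\<close> (first \<open>a\<close>, then \<open>b\<close>), the opposite of the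
  convention of \<open>BijGroup\<close>.\<close>
definition Sbr_h_group ::
  "'a set \<Rightarrow> ('e, 'a) soft_set set \<Rightarrow> 'e set \<Rightarrow> ('a \<Rightarrow> 'a) monoid" where
  "Sbr_h_group X \<tau> E =
     \<lparr>carrier = Sbr_h X \<tau> E,
      mult = (\<lambda>a b. compose X b a),
      one = (\<lambda>x\<in>X. x)\<rparr>"

end

theory Submission
  imports Defs
begin

text \<open>
  Pulling soft sets back along \<open>f\<close> is contravariantly functorial, so the \<open>\<beta>\<close>-irresolute maps
  contain the identity and are closed under composition. Those
  bijections of \<open>X\<close> that are \<open>\<beta>\<close>-irresolute together with their inverses therefore satisfy the
  closure properties of a subgroup of the symmetric group \<open>BijGroup X\<close>; closure under products uses
  that the inverse of a composite is the composite of the inverses in the opposite order.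
  Since the product on \<open>Sbr_h\<close> is the opposite one, the group axioms are read
  off from those of \<open>BijGroup X\<close> with the factors exchanged.
\<close>

lemma soft_vimage_compose:
  assumes "f \<in> X \<rightarrow> Y"
  shows "soft_vimage X E (compose X g f) G = soft_vimage X E f (soft_vimage Y E g G)"
  using assms by (fastforce simp: soft_vimage_def compose_def)

lemma soft_vimage_id:
  assumes "G \<in> soft_sets X E"
  shows "soft_vimage X E (\<lambda>x\<in>X. x) G = G"
proof (rule extensionalityI[of _ E])
  fix e assume "e \<in> E"
  with assms have "G e \<subseteq> X"
    by (auto simp: soft_sets_def)
  with \<open>e \<in> E\<close> show "soft_vimage X E (\<lambda>x\<in>X. x) G e = G e"
    by (auto simp: soft_vimage_def)
qed (use assms in \<open>auto simp: soft_vimage_def soft_sets_def PiE_def\<close>)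

lemma soft_beta_irresolute_compose:
  assumes f: "soft_beta_irresolute X \<tau> Y \<tau>' E f"
    and g: "soft_beta_irresolute Y \<tau>' Z \<tau>'' E g"
  shows "soft_beta_irresolute X \<tau> Z \<tau>'' E (compose X g f)"
proof -
  have "f \<in> X \<rightarrow> Y"
    using f by (simp add: soft_beta_irresolute_def)
  moreover from this g have "compose X g f \<in> X \<rightarrow> Z"
    by (auto simp: soft_beta_irresolute_def compose_def)
  ultimately show ?thesis
    using f g by (simp add: soft_beta_irresolute_def soft_vimage_compose)
qed

lemma soft_beta_irresolute_id: "soft_beta_irresolute X \<tau> X \<tau> E (\<lambda>x\<in>X. x)"
  by (auto simp: soft_beta_irresolute_def soft_beta_open_def soft_vimage_id)

text \<open>
  In this form the inverse maps occurring in \<open>Sbr_h\<close> are governed by the general group laws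
  for double inverses and inverses of products.
\<close>
lemma Sbr_h_BijGroup:
  "Sbr_h X \<tau> E =
     {f \<in> carrier (BijGroup X). soft_beta_irresolute X \<tau> X \<tau> E f \<and>
        soft_beta_irresolute X \<tau> X \<tau> E (inv\<^bsub>BijGroup X\<^esub> f)}"
proof -
  have "carrier (BijGroup X) = Bij X"
    by (simp add: BijGroup_def)
  then show ?thesis
    by (auto simp: Sbr_h_def inv_BijGroup)
qed

lemma mult_BijGroup:
  "f \<in> carrier (BijGroup X) \<Longrightarrow> g \<in> carrier (BijGroup X) \<Longrightarrow>
    g \<otimes>\<^bsub>BijGroup X\<^esub> f = compose X g f"
  by (simp add: BijGroup_def)

lemma one_BijGroup: "\<one>\<^bsub>BijGroup X\<^esub> = (\<lambda>x\<in>X. x)"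
  by (simp add: BijGroup_def)

lemma subgroup_Sbr_h: "subgroup (Sbr_h X \<tau> E) (BijGroup X)"
proof -
  interpret B: group "BijGroup X"
    by (rule group_BijGroup)
  show ?thesis
  proof (rule B.subgroupI)
    have "\<one>\<^bsub>BijGroup X\<^esub> \<in> Sbr_h X \<tau> E"
      unfolding Sbr_h_BijGroup using soft_beta_irresolute_id[of X \<tau> E]
      by (simp flip: one_BijGroup)
    then show "Sbr_h X \<tau> E \<noteq> {}"
      by blast
  next
    fix f g assume "f \<in> Sbr_h X \<tau> E" "g \<in> Sbr_h X \<tau> E"
    then show "f \<otimes>\<^bsub>BijGroup X\<^esub> g \<in> Sbr_h X \<tau> E"
      unfolding Sbr_h_BijGroup
      by (auto simp: B.inv_mult_group)
        (simp_all add: mult_BijGroup soft_beta_irresolute_compose)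
  qed (auto simp: Sbr_h_BijGroup)
qed

theorem theorem4p11:
  fixes X :: "'a set" and E :: "'e set" and \<tau> :: "('e, 'a) soft_set set"
  assumes "soft_topological_space X \<tau> E"
  shows "group (Sbr_h_group X \<tau> E)"
proof -
  interpret B: group "BijGroup X"
    by (rule group_BijGroup)
  interpret H: subgroup "Sbr_h X \<tau> E" "BijGroup X"
    by (rule subgroup_Sbr_h)
  let ?G = "Sbr_h_group X \<tau> E"
  have carrier: "carrier ?G = Sbr_h X \<tau> E"
    and one: "\<one>\<^bsub>?G\<^esub> = \<one>\<^bsub>BijGroup X\<^esub>"
    by (simp_all add: Sbr_h_group_def one_BijGroup)
  have mult: "a \<otimes>\<^bsub>?G\<^esub> b = b \<otimes>\<^bsub>BijGroup X\<^esub> a" if "a \<in> Sbr_h X \<tau> E" "b \<in> Sbr_h X \<tau> E" for a b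
    using that by (simp add: Sbr_h_group_def mult_BijGroup)
  show ?thesis
  proof (rule groupI)
    fix a assume "a \<in> carrier ?G"
    then show "\<exists>b\<in>carrier ?G. b \<otimes>\<^bsub>?G\<^esub> a = \<one>\<^bsub>?G\<^esub>"
      by (intro bexI[of _ "inv\<^bsub>BijGroup X\<^esub> a"]) (simp_all add: carrier one mult)
  qed (simp_all add: carrier one mult B.m_assoc)
qed

end
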